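(* Let $G=SL_n(\mathbb{C})$, let $\phi:T^*G/B=G\times^B\underline{b}_u\to\mathcal{G}/\mathcal{B}$ be the map $\phi(g,Y)=g(Id+t^{-1}Y+t^{-2}Y^2+\cdots)\ (\mathrm{mod}\ \mathcal{B})$, let $\pi:\mathcal{G}/\mathcal{B}\to\mathcal{G}/G_0$ be the canonical projection, and let $\mathcal{N}$ be the variety of nilpotent matrices in $\mathfrak{sl}_n(\mathbb{C})$, identified with its image under the injective map $\psi:\mathcal{N}\to\mathcal{G}/G_0$, $\psi(N)=(Id+t^{-1}N+t^{-2}N^2+\cdots)\ (\mathrm{mod}\ G_0)$. Then, identifying $T^*G/B$ with its image under $\phi$, one has $\pi(T^*G/B)=\mathcal{N}$, and $\pi|_{T^*G/B}:T^*G/B\to\mathcal{N}$ is the Springer resolution $(g,Y)\mapsto gYg^{-1}$. Explicitly, $\pi(\phi(T^*G/B))=\psi(\mathcal{N})$ and $\pi(\phi(g,Y))=\psi(gYg^{-1})$ for all $g\in G$, $Y\in\underline{b}_u$.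
   Context: Let $n\ge 2$, $K=\mathbb{C}$, $A=K[[t]]$, $F=K((t))$, $G=SL_n(K)$, $B$ the Borel subgroup of upper triangular matrices, $\underline{b}_u$ the Lie algebra of its unipotent radical (strictly upper triangular matrices). Put $\mathcal{G}=SL_n(F)$, $G_0=SL_n(A)$, and let $\mathcal{B}\subset G_0$ be the preimage of $B$ under $G_0\to G$, $t\mapsto 0$. The cotangent bundle is $T^*G/B=G\times^B\underline{b}_u=(G\times\underline{b}_u)/\sim$, where $(g,Y)\sim(gb,b^{-1}Yb)$ for $b\in B$. The sums defining $\phi$ and $\psi$ are finite because the matrices involved are nilpotent; $\phi$ and $\psi$ are well defined and injective. The Springer resolution is the map $G\times^B\underline{b}_u\to\mathcal{N}$, $(g,Y)\mapsto gYg^{-1}$. *)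

theory Defs
  imports
    "HOL-Algebra.Left_Coset"
    "HOL-Computational_Algebra.Formal_Laurent_Series"
    "Jordan_Normal_Form.Determinant"
begin

definition SL :: "nat \<Rightarrow> 'a::comm_ring_1 mat monoid" where
  "SL n = \<lparr>carrier = {M \<in> carrier_mat n n. det M = 1}, monoid.mult = (*), one = 1\<^sub>m n\<rparr>"

abbreviation SLC :: "nat \<Rightarrow> complex mat monoid" where
  "SLC n \<equiv> SL n"

definition borel_subgroup :: "nat \<Rightarrow> complex mat set" where
  "borel_subgroup n = {b \<in> carrier (SLC n). upper_triangular b}"

definition b_u :: "nat \<Rightarrow> complex mat set" where
  "b_u n = {Y \<in> carrier_mat n n. \<forall>i<n. \<forall>j\<le>i. Y $$ (i, j) = 0}"

definition nilpotent_cone :: "nat \<Rightarrow> complex mat set" where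
  "nilpotent_cone n =
     {N \<in> carrier_mat n n. (\<Sum>i<n. N $$ (i, i)) = 0 \<and> (\<exists>k. N ^\<^sub>m k = 0\<^sub>m n n)}"

abbreviation loop_group :: "nat \<Rightarrow> complex fls mat monoid" where
  "loop_group n \<equiv> SL n"

text \<open>The subgroups of the loop group coming from \<^term>\<open>SL n\<close> over the power series ring:
  \<open>loop_G0 n\<close> is all of it and \<open>iwahori n\<close> is the preimage of the Borel subgroup under
  evaluation at \<open>t = 0\<close>.\<close>

definition loop_G0 :: "nat \<Rightarrow> complex fls mat set" where
  "loop_G0 n = map_mat fps_to_fls ` carrier (SL n)"

definition iwahori :: "nat \<Rightarrow> complex fls mat set" where
  "iwahori n = map_mat fps_to_fls `
     {M \<in> carrier (SL n). map_mat (\<lambda>f. fps_nth f 0) M \<in> borel_subgroup n}"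

abbreviation affine_flags :: "nat \<Rightarrow> complex fls mat set set" where
  "affine_flags n \<equiv> lcosets\<^bsub>loop_group n\<^esub> iwahori n"

abbreviation affine_grassmannian :: "nat \<Rightarrow> complex fls mat set set" where
  "affine_grassmannian n \<equiv> lcosets\<^bsub>loop_group n\<^esub> loop_G0 n"

definition cotangent_rel :: "nat \<Rightarrow> ((complex mat \<times> complex mat) \<times> (complex mat \<times> complex mat)) set" where
  "cotangent_rel n = {((g, Y), (g * b, inv\<^bsub>SLC n\<^esub> b * Y * b)) | g Y b.
     g \<in> carrier (SLC n) \<and> Y \<in> b_u n \<and> b \<in> borel_subgroup n}"

definition cotangent_bundle :: "nat \<Rightarrow> (complex mat \<times> complex mat) set set" where
  "cotangent_bundle n = (carrier (SLC n) \<times> b_u n) // cotangent_rel n"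

abbreviation cotangent_class :: "nat \<Rightarrow> complex mat \<Rightarrow> complex mat \<Rightarrow> (complex mat \<times> complex mat) set" where
  "cotangent_class n g Y \<equiv> cotangent_rel n `` {(g, Y)}"

text \<open>The series \<open>Id + t\<^sup>-\<^sup>1 N + t\<^sup>-\<^sup>2 N\<^sup>2 + \<dots>\<close>, summed over its nonzero terms; for nilpotent
  \<open>N\<close> there are finitely many. The variable \<open>t\<close> is \<^term>\<open>fls_X\<close>.\<close>

definition geometric_mat :: "nat \<Rightarrow> complex mat \<Rightarrow> complex fls mat" where
  "geometric_mat n N = mat n n (\<lambda>(i, j).
     \<Sum>k | N ^\<^sub>m k \<noteq> 0\<^sub>m n n. fls_X_inv ^ k * fls_const ((N ^\<^sub>m k) $$ (i, j)))"

definition phi_rep :: "nat \<Rightarrow> complex mat \<Rightarrow> complex mat \<Rightarrow> complex fls mat set" where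
  "phi_rep n g Y = (map_mat fls_const g * geometric_mat n Y) <#\<^bsub>loop_group n\<^esub> iwahori n"

text \<open>A map on a quotient set induced by a map \<open>f\<close> on representatives sends a class \<open>X\<close> to the
  unique element of \<open>f ` X\<close>; this is \<^term>\<open>the_elem (f ` X)\<close>.\<close>

definition phi :: "nat \<Rightarrow> (complex mat \<times> complex mat) set \<Rightarrow> complex fls mat set" where
  "phi n X = the_elem ((\<lambda>(g, Y). phi_rep n g Y) ` X)"

definition springer :: "nat \<Rightarrow> (complex mat \<times> complex mat) set \<Rightarrow> complex mat" where
  "springer n X = the_elem ((\<lambda>(g, Y). g * Y * inv\<^bsub>SLC n\<^esub> g) ` X)"

definition flag_proj :: "nat \<Rightarrow> complex fls mat set \<Rightarrow> complex fls mat set" where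
  "flag_proj n X = the_elem ((\<lambda>x. x <#\<^bsub>loop_group n\<^esub> loop_G0 n) ` X)"

definition psi :: "nat \<Rightarrow> complex mat \<Rightarrow> complex fls mat set" where
  "psi n N = geometric_mat n N <#\<^bsub>loop_group n\<^esub> loop_G0 n"

end

theory Submission
  imports Defs "Jordan_Normal_Form.Schur_Decomposition"
begin

text \<open>
  Write \<open>G(N) = Id + t\<^sup>-\<^sup>1 N + t\<^sup>-\<^sup>2 N\<^sup>2 + \<dots>\<close> for nilpotent \<open>N\<close>. The proof works with the matrix
  \<open>Id - t\<^sup>-\<^sup>1 N\<close> instead of the series: telescoping shows that the two are inverse to each other
  (\<open>resolvent_pencil_mult_geometric_mat\<close>). Every nilpotent matrix is conjugate, by an element of
  \<open>SL\<^sub>n(\<complex>)\<close>, to a strictly upper triangular one (\<open>nilpotent_conj_b_u\<close>), so \<open>Id - t\<^sup>-\<^sup>1 N\<close> has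
  determinant 1 and \<open>G(N)\<close> is an element of the loop group (\<open>geometric_mat_eq_inv\<close>).

  Since inversion commutes with conjugation, \<open>g G(Y) g\<^sup>-\<^sup>1 = G(g Y g\<^sup>-\<^sup>1)\<close>. Absorbing the constant
  matrix \<open>g\<^sup>-\<^sup>1\<close> into \<open>G\<^sub>0\<close> gives \<open>\<pi>(\<phi>(g, Y)) = \<psi>(g Y g\<^sup>-\<^sup>1)\<close> (\<open>flag_proj_phi_rep\<close>), and absorbing a
  constant \<open>b\<close> in the Borel subgroup into the Iwahori subgroup shows that \<open>\<phi>\<close> is well defined. The
  image of \<open>\<pi> \<circ> \<phi>\<close> is the whole image of \<open>\<psi>\<close> because every nilpotent matrix is
  conjugate to a strictly upper triangular one.

  Both injectivity statements come from one rigidity fact (\<open>coset_rigidity\<close>). If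
  \<open>h G(N) = G(N') M\<close> with \<open>h\<close> constant and \<open>M\<close> over the power series ring, then
  \<open>M = (Id - t\<^sup>-\<^sup>1 N') h G(N)\<close> is a polynomial in \<open>t\<^sup>-\<^sup>1\<close> with constant term \<open>h\<close> and at the same time
  a power series in \<open>t\<close>. So \<open>M\<close> is the constant \<open>h\<close>, and comparing the coefficients of \<open>t\<^sup>-\<^sup>1\<close> in
  \<open>M (Id - t\<^sup>-\<^sup>1 N) = (Id - t\<^sup>-\<^sup>1 N') h\<close> gives \<open>h N = N' h\<close>.
\<close>

section \<open>The groups and their subgroups\<close>

lemma carrier_SL [simp]: "M \<in> carrier (SL n) \<longleftrightarrow> M \<in> carrier_mat n n \<and> det M = 1"
  by (simp add: SL_def)

lemma SL_carrier_mat: "M \<in> carrier (SL n) \<Longrightarrow> M \<in> carrier_mat n n"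
  by simp

lemma mult_SL [simp]: "M \<otimes>\<^bsub>SL n\<^esub> N = M * N"
  by (simp add: SL_def)

lemma one_SL [simp]: "\<one>\<^bsub>SL n\<^esub> = 1\<^sub>m n"
  by (simp add: SL_def)

lemma group_SL: "group (SL n :: 'a::comm_ring_1 mat monoid)"
proof (rule groupI)
  fix M :: "'a mat" assume "M \<in> carrier (SL n)"
  then have M: "M \<in> carrier_mat n n" "det M = 1" by auto
  have inv: "adj_mat M * M = 1\<^sub>m n" using adj_mat[OF M(1)] M(2) by auto
  then have "det (adj_mat M) * det M = 1"
    using adj_mat(1)[OF M(1)] M(1) by (metis det_mult det_one)
  then show "\<exists>N\<in>carrier (SL n). N \<otimes>\<^bsub>SL n\<^esub> M = \<one>\<^bsub>SL n\<^esub>"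
    using inv adj_mat(1)[OF M(1)] M(2) by auto
qed (auto simp: det_mult assoc_mult_mat[of _ n n _ n _ n])

lemma inv_SL:
  fixes M :: "'a::comm_ring_1 mat"
  assumes "M \<in> carrier (SL n)"
  shows "inv\<^bsub>SL n\<^esub> M \<in> carrier_mat n n" "det (inv\<^bsub>SL n\<^esub> M) = 1"
    "M * inv\<^bsub>SL n\<^esub> M = 1\<^sub>m n" "inv\<^bsub>SL n\<^esub> M * M = 1\<^sub>m n"
proof -
  interpret group "SL n :: 'a mat monoid" by (rule group_SL)
  show "inv\<^bsub>SL n\<^esub> M \<in> carrier_mat n n" "det (inv\<^bsub>SL n\<^esub> M) = 1"
    "M * inv\<^bsub>SL n\<^esub> M = 1\<^sub>m n" "inv\<^bsub>SL n\<^esub> M * M = 1\<^sub>m n"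
    using inv_closed[OF assms] r_inv[OF assms] l_inv[OF assms] by simp_all
qed

lemma group_hom_map_mat_SL:
  assumes "comm_ring_hom h"
  shows "group_hom (SL n) (SL n) (map_mat h)"
proof -
  interpret comm_ring_hom h by fact
  have "map_mat h \<in> hom (SL n) (SL n)"
    by (auto simp: hom_def mat_hom_mult[of _ n n _ n])
  then show ?thesis
    by (simp add: group_hom_def group_hom_axioms_def group_SL)
qed

lemma b_u_mult_upper_triangular:
  assumes A: "A \<in> carrier_mat n n" "upper_triangular A" and Y: "Y \<in> b_u n"
  shows "A * Y \<in> b_u n" "Y * A \<in> b_u n"
proof -
  have Yc: "Y \<in> carrier_mat n n" and Y0: "\<And>i j. i < n \<Longrightarrow> j \<le> i \<Longrightarrow> Y $$ (i, j) = 0"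
    using Y by (auto simp: b_u_def)
  have A0: "A $$ (i, j) = 0" if "i < n" "j < i" for i j
    using A that by auto
  have "A $$ (i, k) * Y $$ (k, j) = 0" if "i < n" "j \<le> i" "k < n" for i j k
    using A0[of i k] Y0[of k j] that by (cases "k < i") auto
  moreover have "Y $$ (i, k) * A $$ (k, j) = 0" if "i < n" "j \<le> i" "k < n" for i j k
    using Y0[of i k] A0[of k j] that by (cases "k \<le> i") auto
  ultimately show "A * Y \<in> b_u n" "Y * A \<in> b_u n"
    using A(1) Yc by (auto simp: b_u_def scalar_prod_def intro!: sum.neutral)
qed

lemma upper_triangular_mult:
  fixes A B :: "'a::semiring_0 mat"
  assumes "A \<in> carrier_mat n n" "B \<in> carrier_mat n n" "upper_triangular A" "upper_triangular B"
  shows "upper_triangular (A * B)"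
proof
  fix i j assume ij: "j < i" "i < dim_row (A * B)"
  have "A $$ (i, k) * B $$ (k, j) = 0" if "k < n" for k
    using upper_triangularD[OF assms(3), of k i] upper_triangularD[OF assms(4), of j k] assms(1,2) ij that
    by (cases "k < i") auto
  then show "(A * B) $$ (i, j) = 0"
    using assms ij by (auto simp: scalar_prod_def intro!: sum.neutral)
qed

text \<open>Upper triangularity of the inverse is read off from \<open>A * B = 1\<close> one row at a time, from the
  bottom row upwards: below the diagonal, the entry \<open>(i, j)\<close> of the product reduces to
  \<open>A\<^bsub>ii\<^esub> B\<^bsub>ij\<^esub>\<close> once the rows of \<open>B\<close> below row \<open>i\<close> are known, and \<open>A\<^bsub>ii\<^esub>\<close> is not zero because
  \<open>det A\<close> is the product of the diagonal.\<close>
lemma upper_triangular_inverse: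
  fixes A B :: "'a::idom mat"
  assumes A: "A \<in> carrier_mat n n" "upper_triangular A" "det A \<noteq> 0"
    and B: "B \<in> carrier_mat n n" and AB: "A * B = 1\<^sub>m n"
  shows "upper_triangular B"
proof -
  have diag: "A $$ (i, i) \<noteq> 0" if "i < n" for i
  proof
    assume "A $$ (i, i) = 0"
    then have "0 \<in> set (diag_mat A)" using A(1) that by (force simp: diag_mat_def)
    then show False using A by (simp add: det_upper_triangular prod_list_zero_iff)
  qed
  have "B $$ (i, j) = 0" if "i < n" "j < i" for i j
    using that
  proof (induction "n - i" arbitrary: i rule: less_induct)
    case less
    have "0 = (A * B) $$ (i, j)" using AB less.prems by simp
    also have "\<dots> = (\<Sum>k\<in>{0..<n}. A $$ (i, k) * B $$ (k, j))"
      using A(1) B less.prems by (simp add: scalar_prod_def)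
    also have "\<dots> = (\<Sum>k\<in>{0..<n}. if k = i then A $$ (i, i) * B $$ (i, j) else 0)"
    proof (rule sum.cong)
      fix k assume k: "k \<in> {0..<n}"
      show "A $$ (i, k) * B $$ (k, j) = (if k = i then A $$ (i, i) * B $$ (i, j) else 0)"
        using less.hyps[of k] less.prems k A by (cases k i rule: linorder_cases) auto
    qed simp
    also have "\<dots> = A $$ (i, i) * B $$ (i, j)" using less.prems by simp
    finally show ?case using diag[of i] less.prems by simp
  qed
  then show ?thesis using B by auto
qed

lemma subgroup_borel: "subgroup (borel_subgroup n) (SLC n)"
proof -
  interpret group "SLC n" by (rule group_SL)
  show ?thesis
  proof (rule subgroupI)
    show "borel_subgroup n \<noteq> {}" by (auto simp: borel_subgroup_def intro!: exI[of _ "1\<^sub>m n"])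
  next
    fix b assume "b \<in> borel_subgroup n"
    then have b: "b \<in> carrier (SLC n)" "upper_triangular b" by (auto simp: borel_subgroup_def)
    show "inv\<^bsub>SLC n\<^esub> b \<in> borel_subgroup n"
      using upper_triangular_inverse[of b n "inv\<^bsub>SLC n\<^esub> b"] inv_SL[OF b(1)] b
      by (simp add: borel_subgroup_def)
  qed (auto simp: borel_subgroup_def det_mult upper_triangular_mult)
qed

lemma b_u_carrier: "Y \<in> b_u n \<Longrightarrow> Y \<in> carrier_mat n n"
  by (simp add: b_u_def)

lemma b_u_conj_borel:
  assumes "Y \<in> b_u n" "b \<in> borel_subgroup n"
  shows "inv\<^bsub>SLC n\<^esub> b * Y * b \<in> b_u n"
proof -
  let ?c = "inv\<^bsub>SLC n\<^esub> b"
  have c: "?c \<in> borel_subgroup n" using subgroup.m_inv_closed[OF subgroup_borel assms(2)] .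
  have "?c * Y \<in> b_u n"
    using c assms(1) by (auto simp: borel_subgroup_def intro: b_u_mult_upper_triangular(1))
  then show ?thesis
    using assms(2) by (auto simp: borel_subgroup_def intro: b_u_mult_upper_triangular(2))
qed

lemma comm_ring_hom_fps_to_fls: "comm_ring_hom (fps_to_fls :: 'a::comm_ring_1 fps \<Rightarrow> 'a fls)"
  by unfold_locales (simp_all add: fls_times_fps_to_fls)

lemma comm_ring_hom_fls_const: "comm_ring_hom (fls_const :: 'a::comm_ring_1 \<Rightarrow> 'a fls)"
  by unfold_locales (simp_all add: fls_plus_const)

lemma comm_ring_hom_fps_nth_0: "comm_ring_hom (\<lambda>f :: 'a::comm_ring_1 fps. fps_nth f 0)"
  by unfold_locales simp_all

lemma comm_ring_hom_fps_const: "comm_ring_hom (fps_const :: 'a::comm_ring_1 \<Rightarrow> 'a fps)"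
  by unfold_locales simp_all

lemma subgroup_loop_G0: "subgroup (loop_G0 n) (loop_group n)"
proof -
  interpret group_hom "SL n" "loop_group n" "map_mat fps_to_fls"
    by (rule group_hom_map_mat_SL[OF comm_ring_hom_fps_to_fls])
  show ?thesis unfolding loop_G0_def by (rule img_is_subgroup)
qed

text \<open>Evaluation at \<open>t = 0\<close> and the inclusion of power series into Laurent series both induce group
  homomorphisms, and the Iwahori subgroup is the image under the second of a preimage under the
  first.\<close>
lemma subgroup_iwahori: "subgroup (iwahori n) (loop_group n)"
proof -
  interpret f: group_hom "SL n" "loop_group n" "map_mat fps_to_fls"
    by (rule group_hom_map_mat_SL[OF comm_ring_hom_fps_to_fls])
  interpret e: group_hom "SL n" "SLC n" "map_mat (\<lambda>f. fps_nth f 0)"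
    by (rule group_hom_map_mat_SL[OF comm_ring_hom_fps_nth_0])
  interpret b: subgroup "borel_subgroup n" "SLC n" by (rule subgroup_borel)
  have "subgroup {M \<in> carrier (SL n). map_mat (\<lambda>f. fps_nth f 0) M \<in> borel_subgroup n} (SL n)"
  proof (rule f.G.subgroupI, goal_cases)
    case 2
    show ?case using e.hom_one b.one_closed by (metis (mono_tags, lifting) f.G.one_closed empty_iff mem_Collect_eq)
  next
    case (3 M)
    then show ?case using e.hom_inv[of M] b.m_inv_closed f.G.inv_closed[of M] by (metis (mono_tags, lifting) mem_Collect_eq)
  next
    case (4 M N)
    then show ?case using e.hom_mult[of M N] b.m_closed f.G.m_closed[of M N] by (metis (mono_tags, lifting) mem_Collect_eq)
  qed auto
  then show ?thesis unfolding iwahori_def by (rule f.subgroup_img_is_subgroup)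
qed

lemma iwahori_subset: "iwahori n \<subseteq> loop_G0 n"
  by (auto simp: iwahori_def loop_G0_def)

text \<open>Constant matrices are absorbed on the right by the two subgroups; this is what makes \<open>\<phi>\<close>
  invariant under \<open>B\<close> and turns \<open>g G(Y)\<close> into \<open>G(g Y g\<^sup>-\<^sup>1)\<close> modulo \<open>G\<^sub>0\<close>.\<close>
lemma const_in_loop_G0:
  assumes "g \<in> carrier (SLC n)"
  shows "map_mat fls_const g \<in> loop_G0 n"
    and "g \<in> borel_subgroup n \<Longrightarrow> map_mat fls_const g \<in> iwahori n"
proof -
  interpret group_hom "SLC n" "SL n" "map_mat fps_const"
    by (rule group_hom_map_mat_SL[OF comm_ring_hom_fps_const])
  have eq: "map_mat fls_const g = map_mat fps_to_fls (map_mat fps_const g)"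
    by (rule eq_matI) simp_all
  have eval: "map_mat (\<lambda>f. fps_nth f 0) (map_mat fps_const g) = g"
    by (rule eq_matI) simp_all
  have mem: "map_mat fps_const g \<in> carrier (SL n)" using hom_closed[OF assms] .
  show "map_mat fls_const g \<in> loop_G0 n"
    unfolding loop_G0_def eq using mem by (rule imageI)
  show "map_mat fls_const g \<in> iwahori n" if "g \<in> borel_subgroup n"
    unfolding iwahori_def eq by (rule imageI) (use mem that eval in simp)
qed

section \<open>Nilpotent matrices are the conjugates of strictly upper triangular ones\<close>

lemma b_u_power_zero:
  assumes "Y \<in> b_u n"
  shows "Y ^\<^sub>m n = 0\<^sub>m n n"
proof -
  have Yc: "Y \<in> carrier_mat n n" and Y0: "\<And>i j. i < n \<Longrightarrow> j \<le> i \<Longrightarrow> Y $$ (i, j) = 0"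
    using assms by (auto simp: b_u_def)
  \<comment> \<open>Each factor \<open>Y\<close> pushes the support of the power one diagonal further to the right.\<close>
  have "(Y ^\<^sub>m k) $$ (i, j) = 0" if "i < n" "j < n" "j < i + k" for i j k
    using that
  proof (induction k arbitrary: i j)
    case 0
    then show ?case using Yc by simp
  next
    case (Suc k)
    have "(Y ^\<^sub>m k) $$ (i, l) * Y $$ (l, j) = 0" if "l < n" for l
      using Suc.IH[of i l] Y0[of l j] Suc.prems that by (cases "l < i + k") auto
    then show ?case
      using Suc.prems Yc pow_carrier_mat[OF Yc, of k]
      by (auto simp: scalar_prod_def intro!: sum.neutral)
  qed
  then show ?thesis using pow_carrier_mat[OF Yc, of n] by (intro eq_matI) auto
qed

lemma pow_mat_Suc_left:
  assumes "A \<in> carrier_mat n n"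
  shows "A ^\<^sub>m Suc k = A * A ^\<^sub>m k"
proof (induction k)
  case (Suc k)
  have "A ^\<^sub>m Suc (Suc k) = (A * A ^\<^sub>m k) * A" using Suc by simp
  then show ?case using assms by (simp add: assoc_mult_mat[of _ n n _ n _ n])
qed (use assms in simp)

lemma smult_smult_mat: "a \<cdot>\<^sub>m (b \<cdot>\<^sub>m A) = (a * b :: 'a::semigroup_mult) \<cdot>\<^sub>m A"
  by (rule eq_matI) (simp_all add: mult.assoc)

lemma sum_diag_mult_commute:
  fixes A B :: "'a::comm_semiring_0 mat"
  assumes "A \<in> carrier_mat n n" "B \<in> carrier_mat n n"
  shows "(\<Sum>i<n. (A * B) $$ (i, i)) = (\<Sum>i<n. (B * A) $$ (i, i))"
proof -
  have "(\<Sum>i<n. (A * B) $$ (i, i)) = (\<Sum>i<n. \<Sum>j<n. A $$ (i, j) * B $$ (j, i))"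
    using assms by (simp add: scalar_prod_def lessThan_atLeast0)
  also have "\<dots> = (\<Sum>j<n. \<Sum>i<n. B $$ (j, i) * A $$ (i, j))"
    by (subst sum.swap) (simp add: mult.commute)
  also have "\<dots> = (\<Sum>i<n. (B * A) $$ (i, i))"
    using assms by (simp add: scalar_prod_def lessThan_atLeast0)
  finally show ?thesis .
qed

lemma conj_b_u_nilpotent:
  assumes g: "g \<in> carrier (SLC n)" and Y: "Y \<in> b_u n"
  shows "g * Y * inv\<^bsub>SLC n\<^esub> g \<in> nilpotent_cone n"
proof -
  let ?h = "inv\<^bsub>SLC n\<^esub> g"
  note h = inv_SL[OF g]
  have gc: "g \<in> carrier_mat n n" using g by simp
  have Yc: "Y \<in> carrier_mat n n" using Y by (simp add: b_u_def)
  have "(\<Sum>i<n. (g * Y * ?h) $$ (i, i)) = (\<Sum>i<n. (?h * (g * Y)) $$ (i, i))"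
    by (rule sum_diag_mult_commute) (use gc Yc h in auto)
  also have "?h * (g * Y) = Y"
    using assoc_mult_mat[OF h(1) gc Yc] h(4) Yc by simp
  also have "(\<Sum>i<n. Y $$ (i, i)) = 0" using Y by (simp add: b_u_def)
  finally have trace: "(\<Sum>i<n. (g * Y * ?h) $$ (i, i)) = 0" .
  have "similar_mat_wit (g * Y * ?h) Y g ?h"
    using gc Yc h by (intro similar_mat_witI[of _ _ n]) auto
  from similar_mat_wit_pow_id[OF this, of n]
  have "(g * Y * ?h) ^\<^sub>m n = g * (Y ^\<^sub>m n) * ?h" .
  also have "\<dots> = 0\<^sub>m n n" using b_u_power_zero[OF Y] gc h(1) by simp
  finally show ?thesis using trace gc Yc h(1) by (auto simp: nilpotent_cone_def)
qed

text \<open>For triangular matrices, taking powers takes powers of the diagonal entries, so these vanish.\<close>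
lemma nilpotent_upper_triangular:
  assumes B: "B \<in> carrier_mat n n" "upper_triangular B" and nil: "B ^\<^sub>m k = 0\<^sub>m n n"
  shows "B \<in> b_u n"
proof -
  have "upper_triangular (B ^\<^sub>m m) \<and> (\<forall>i<n. (B ^\<^sub>m m) $$ (i, i) = (B $$ (i, i)) ^ m)" for m
  proof (induction m)
    case 0
    then show ?case using B by simp
  next
    case (Suc m)
    have Bm: "B ^\<^sub>m m \<in> carrier_mat n n" using B by simp
    have "(B ^\<^sub>m m * B) $$ (i, i) = (B $$ (i, i)) ^ m * B $$ (i, i)" if "i < n" for i
    proof -
      have "(B ^\<^sub>m m * B) $$ (i, i) = (\<Sum>l\<in>{0..<n}. (B ^\<^sub>m m) $$ (i, l) * B $$ (l, i))"
        using B Bm that by (simp add: scalar_prod_def)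
      also have "\<dots> = (\<Sum>l\<in>{0..<n}. if l = i then (B ^\<^sub>m m) $$ (i, i) * B $$ (i, i) else 0)"
      proof (rule sum.cong)
        fix l assume "l \<in> {0..<n}"
        then show "(B ^\<^sub>m m) $$ (i, l) * B $$ (l, i) =
            (if l = i then (B ^\<^sub>m m) $$ (i, i) * B $$ (i, i) else 0)"
          using upper_triangularD[of "B ^\<^sub>m m" l i] upper_triangularD[OF B(2), of i l] Suc.IH B Bm that
          by (cases l i rule: linorder_cases) auto
      qed simp
      finally show ?thesis using Suc.IH that by simp
    qed
    then show ?case using Suc.IH upper_triangular_mult[OF Bm B(1) _ B(2)] by simp
  qed
  then have "B $$ (i, i) = 0" if "i < n" for i
    using that nil by (metis index_zero_mat(1) power_eq_0_iff)
  then show ?thesis using B by (auto simp: b_u_def order.order_iff_strict)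
qed

text \<open>Surjectivity of the Springer resolution. Schur triangularization conjugates \<open>N\<close> to an upper
  triangular matrix, which is strict because \<open>N\<close> is nilpotent. The conjugating matrix \<open>P\<close> need not
  have determinant 1, but multiplying it by a scalar does not change the conjugate, and over the
  complex numbers the scalar can be an \<open>n\<close>-th root of \<open>1 / det P\<close>.\<close>
lemma nilpotent_conj_b_u:
  assumes "0 < n" and N: "N \<in> nilpotent_cone n"
  obtains g Y where "g \<in> carrier (SLC n)" "Y \<in> b_u n" "N = g * Y * inv\<^bsub>SLC n\<^esub> g"
proof -
  obtain k where Nc: "N \<in> carrier_mat n n" and nil: "N ^\<^sub>m k = 0\<^sub>m n n"
    using N by (auto simp: nilpotent_cone_def)
  obtain es where "char_poly N = (\<Prod>e\<leftarrow>es. [:- e, 1:])"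
    using char_poly_factorized[OF Nc] by blast
  then obtain B P Q where sim: "similar_mat_wit N B P Q" and B: "upper_triangular B"
    using schur_decomposition[OF Nc] by (metis prod_cases3)
  note PQ = similar_mat_witD2[OF Nc sim]
  have "B ^\<^sub>m k = Q * N ^\<^sub>m k * P"
    using similar_mat_wit_pow_id[OF similar_mat_wit_sym[OF sim]] .
  then have "B ^\<^sub>m k = 0\<^sub>m n n" using nil PQ by simp
  then have Bu: "B \<in> b_u n" using nilpotent_upper_triangular PQ B by blast
  have dPQ: "det P * det Q = 1" using PQ by (metis det_mult det_one)
  obtain c where c: "c ^ n = det Q"
    using assms(1) by (metis nth_root_exists)
  have c0: "c \<noteq> 0" using c dPQ assms(1) by (auto simp: power_0_left)
  define g where "g = c \<cdot>\<^sub>m P"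
  define h where "h = inverse c \<cdot>\<^sub>m Q"
  have g: "g \<in> carrier (SLC n)" using PQ c dPQ by (simp add: g_def det_smult mult.commute)
  have hc: "h \<in> carrier_mat n n" using PQ by (simp add: h_def)
  have gh: "h * g = 1\<^sub>m n"
    using PQ c0 by (auto simp: g_def h_def mult_smult_distrib[of _ n n _ n] mult_smult_assoc_mat[of _ n n _ n] smult_smult_mat)
  interpret group "SLC n" by (rule group_SL)
  have inv: "inv\<^bsub>SLC n\<^esub> g = h"
  proof -
    have "det h * det g = 1" using gh hc g by (metis det_mult det_one carrier_SL)
    then show ?thesis using inv_equality[of h g] gh hc g by simp
  qed
  have "g * B * h = N"
    using PQ c0 by (auto simp: g_def h_def mult_smult_distrib[of _ n n _ n] mult_smult_assoc_mat[of _ n n _ n] smult_smult_mat)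
  then show ?thesis using that g Bu inv by metis
qed

section \<open>The geometric series as an inverse in the loop group\<close>

text \<open>The resolvent of \<open>N\<close> at the point \<open>t\<close> is \<open>(t Id - N)\<^sup>-\<^sup>1\<close>, which is \<open>t\<^sup>-\<^sup>1\<close> times the inverse
  of this matrix.\<close>
definition resolvent_pencil :: "nat \<Rightarrow> complex mat \<Rightarrow> complex fls mat" where
  "resolvent_pencil n N = 1\<^sub>m n - fls_X_inv \<cdot>\<^sub>m map_mat fls_const N"

text \<open>The set of exponents in \<^const>\<open>geometric_mat\<close> depends on \<open>N\<close>; any bound on the nilpotency index
  gives the same sum over an initial segment, which can be telescoped.\<close>
lemma geometric_mat_truncate:
  assumes N: "N \<in> carrier_mat n n" and nil: "N ^\<^sub>m m = 0\<^sub>m n n"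
  shows "geometric_mat n N = mat n n (\<lambda>(i, j). \<Sum>k<m. fls_X_inv ^ k * fls_const ((N ^\<^sub>m k) $$ (i, j)))"
proof -
  have zero: "N ^\<^sub>m k = 0\<^sub>m n n" if "m \<le> k" for k
    using that
  proof (induction k rule: dec_induct)
    case base
    then show ?case by (rule nil)
  next
    case (step k)
    then show ?case using N by simp
  qed
  then have sub: "{k. N ^\<^sub>m k \<noteq> 0\<^sub>m n n} \<subseteq> {..<m}"
    by (metis (mono_tags, lifting) lessThan_iff mem_Collect_eq not_le_imp_less subsetI)
  show ?thesis
    unfolding geometric_mat_def
    by (intro cong_mat refl, simp) (intro sum.mono_neutral_left sub, auto)
qed

lemma resolvent_pencil_carrier:
  "N \<in> carrier_mat n n \<Longrightarrow> resolvent_pencil n N \<in> carrier_mat n n"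
  by (simp add: resolvent_pencil_def minus_carrier_mat)

lemma geometric_mat_carrier: "geometric_mat n N \<in> carrier_mat n n"
  by (simp add: geometric_mat_def)

lemma fls_const_sum:
  fixes f :: "'b \<Rightarrow> 'a::comm_ring_1"
  shows "fls_const (sum f A) = (\<Sum>x\<in>A. fls_const (f x))"
proof -
  interpret comm_ring_hom "fls_const :: 'a \<Rightarrow> 'a fls" by (rule comm_ring_hom_fls_const)
  show ?thesis by (rule hom_sum)
qed

lemma resolvent_pencil_mult_geometric_mat:
  assumes N: "N \<in> carrier_mat n n" and nil: "N ^\<^sub>m m = 0\<^sub>m n n"
  shows "resolvent_pencil n N * geometric_mat n N = 1\<^sub>m n"
proof (rule eq_matI)
  fix i j assume "i < dim_row (1\<^sub>m n :: complex fls mat)" "j < dim_col (1\<^sub>m n :: complex fls mat)"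
  then have ij: "i < n" "j < n" by simp_all
  let ?c = "fls_const :: complex \<Rightarrow> complex fls"
  let ?G = "geometric_mat n N"
  let ?T = "\<lambda>k. fls_X_inv ^ k * ?c ((N ^\<^sub>m k) $$ (i, j))"
  have G: "?G $$ (l, j) = (\<Sum>k<m. fls_X_inv ^ k * ?c ((N ^\<^sub>m k) $$ (l, j)))" if "l < n" for l
    using geometric_mat_truncate[OF N nil] that ij by simp
  have step: "(\<Sum>l\<in>{0..<n}. ?c (N $$ (i, l)) * ?c ((N ^\<^sub>m k) $$ (l, j)))
      = ?c ((N ^\<^sub>m Suc k) $$ (i, j))" for k
  proof -
    have "N ^\<^sub>m Suc k = N * N ^\<^sub>m k"
      by (rule pow_mat_Suc_left[OF N])
    then show ?thesis
      using N ij by (simp add: scalar_prod_def fls_const_sum)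
  qed
  have "(map_mat ?c N * ?G) $$ (i, j)
      = (\<Sum>l\<in>{0..<n}. \<Sum>k<m. fls_X_inv ^ k * (?c (N $$ (i, l)) * ?c ((N ^\<^sub>m k) $$ (l, j))))"
    using N ij geometric_mat_carrier[of n N] G
    by (simp add: scalar_prod_def sum_distrib_left mult.left_commute del: fls_const_mult_const)
  also have "\<dots> = (\<Sum>k<m. fls_X_inv ^ k * ?c ((N ^\<^sub>m Suc k) $$ (i, j)))"
    by (subst sum.swap) (simp only: sum_distrib_left[symmetric] step)
  finally have prod: "fls_X_inv * (map_mat ?c N * ?G) $$ (i, j) = (\<Sum>k<m. ?T (Suc k))"
    by (simp add: sum_distrib_left mult.assoc)
  have "(resolvent_pencil n N * ?G) $$ (i, j)
      = (?G - (fls_X_inv \<cdot>\<^sub>m map_mat ?c N) * ?G) $$ (i, j)"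
    unfolding resolvent_pencil_def
    using N geometric_mat_carrier[of n N] by (subst minus_mult_distrib_mat[of _ n n _ _ n]) auto
  also have "\<dots> = ?G $$ (i, j) - fls_X_inv * (map_mat ?c N * ?G) $$ (i, j)"
    using N ij geometric_mat_carrier[of n N] by (subst mult_smult_assoc_mat[of _ n n _ n]) auto
  also have "\<dots> = (\<Sum>k<m. ?T k - ?T (Suc k))"
    by (simp only: prod G[OF ij(1)] sum_subtractf)
  also have "\<dots> = ?T 0 - ?T m"
    by (rule sum_lessThan_telescope')
  also have "\<dots> = 1\<^sub>m n $$ (i, j)"
    using N nil ij by simp
  finally show "(resolvent_pencil n N * ?G) $$ (i, j) = 1\<^sub>m n $$ (i, j)" .
qed (use resolvent_pencil_carrier[OF N] geometric_mat_carrier in auto)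

lemma map_fls_const_mult:
  fixes A B :: "'a::comm_ring_1 mat"
  assumes "A \<in> carrier_mat n n" "B \<in> carrier_mat n n"
  shows "map_mat fls_const (A * B) = map_mat fls_const A * map_mat fls_const B"
proof -
  interpret comm_ring_hom "fls_const :: 'a \<Rightarrow> 'a fls" by (rule comm_ring_hom_fls_const)
  show ?thesis by (rule mat_hom_mult[OF assms])
qed

lemma map_fls_const_SL:
  assumes "g \<in> carrier (SLC n)"
  shows "map_mat fls_const g \<in> carrier (loop_group n)"
    and "map_mat fls_const (inv\<^bsub>SLC n\<^esub> g) = inv\<^bsub>loop_group n\<^esub> (map_mat fls_const g)"
proof -
  interpret group_hom "SLC n" "loop_group n" "map_mat fls_const"
    by (rule group_hom_map_mat_SL[OF comm_ring_hom_fls_const])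
  show "map_mat fls_const g \<in> carrier (loop_group n)" using assms by (rule hom_closed)
  show "map_mat fls_const (inv\<^bsub>SLC n\<^esub> g) = inv\<^bsub>loop_group n\<^esub> (map_mat fls_const g)"
    using assms by (rule hom_inv)
qed

text \<open>Conjugation is phrased as \<open>g N = N' g\<close>, without inverses. In this form it passes from matrices to
  pencils by distributivity, and from pencils to geometric series by inverting both sides. It is also
  the form in which injectivity will deliver it.\<close>
lemma resolvent_pencil_intertwine:
  assumes "g \<in> carrier_mat n n" "N \<in> carrier_mat n n" "N' \<in> carrier_mat n n" "g * N = N' * g"
  shows "map_mat fls_const g * resolvent_pencil n N = resolvent_pencil n N' * map_mat fls_const g"
proof -
  let ?c = "map_mat fls_const :: complex mat \<Rightarrow> complex fls mat"
  have "?c g * resolvent_pencil n N = ?c g - fls_X_inv \<cdot>\<^sub>m (?c g * ?c N)"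
    unfolding resolvent_pencil_def using assms(1,2)
    by (simp add: mult_minus_distrib_mat[of _ n n _ n] mult_smult_distrib[of _ n n _ n])
  also have "?c g * ?c N = ?c N' * ?c g"
    using assms by (simp add: map_fls_const_mult[symmetric, of _ n])
  also have "?c g - fls_X_inv \<cdot>\<^sub>m (?c N' * ?c g) = resolvent_pencil n N' * ?c g"
    unfolding resolvent_pencil_def using assms(1,3)
    by (simp add: minus_mult_distrib_mat[of _ n n _ _ n] mult_smult_assoc_mat[of _ n n _ n])
  finally show ?thesis .
qed

lemma nilpotent_cone_carrier: "N \<in> nilpotent_cone n \<Longrightarrow> N \<in> carrier_mat n n"
  by (simp add: nilpotent_cone_def)

lemma b_u_nilpotent: "Y \<in> b_u n \<Longrightarrow> Y \<in> nilpotent_cone n"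
  using b_u_power_zero[of Y n] by (auto simp: nilpotent_cone_def b_u_def)

lemma conj_SL_intertwine:
  assumes "g \<in> carrier (SLC n)" "Y \<in> carrier_mat n n"
  shows "g * Y * inv\<^bsub>SLC n\<^esub> g * g = g * Y"
proof -
  have "g * Y * inv\<^bsub>SLC n\<^esub> g * g = g * Y * (inv\<^bsub>SLC n\<^esub> g * g)"
    using assms inv_SL[OF assms(1)] by (intro assoc_mult_mat[of _ n n _ n _ n]) auto
  then show ?thesis using assms inv_SL[OF assms(1)] by simp
qed

text \<open>The determinant is invariant under conjugation, and for a strictly upper triangular matrix the
  pencil is upper triangular with ones on the diagonal.\<close>
lemma det_resolvent_pencil:
  assumes "0 < n" and N: "N \<in> nilpotent_cone n"
  shows "det (resolvent_pencil n N) = 1"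
proof -
  obtain g Y where g: "g \<in> carrier (SLC n)" and Y: "Y \<in> b_u n"
    and NY: "N = g * Y * inv\<^bsub>SLC n\<^esub> g"
    using nilpotent_conj_b_u[OF assms] .
  note Nc = nilpotent_cone_carrier[OF N] and Yc = b_u_carrier[OF Y]
  have gl: "map_mat fls_const g \<in> carrier (loop_group n)" by (rule map_fls_const_SL[OF g])
  have "map_mat fls_const g * resolvent_pencil n Y = resolvent_pencil n N * map_mat fls_const g"
    using conj_SL_intertwine[OF g Yc] g Yc Nc NY
    by (intro resolvent_pencil_intertwine) auto
  then have "det (resolvent_pencil n N) = det (resolvent_pencil n Y)"
    using gl resolvent_pencil_carrier[OF Nc] resolvent_pencil_carrier[OF Yc]
    by (metis carrier_SL det_mult mult.right_neutral mult.left_neutral)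
  also have "\<dots> = prod_list (diag_mat (resolvent_pencil n Y))"
    using Y resolvent_pencil_carrier[OF Yc]
    by (intro det_upper_triangular) (auto simp: b_u_def resolvent_pencil_def)
  also have "diag_mat (resolvent_pencil n Y) = map (\<lambda>_. 1) [0..<n]"
    using Y by (auto simp: diag_mat_def b_u_def resolvent_pencil_def)
  finally show ?thesis by (simp add: map_replicate_const)
qed

lemma geometric_mat_eq_inv:
  assumes "0 < n" and N: "N \<in> nilpotent_cone n"
  shows "resolvent_pencil n N \<in> carrier (loop_group n)"
    and "geometric_mat n N \<in> carrier (loop_group n)"
    and "geometric_mat n N = inv\<^bsub>loop_group n\<^esub> (resolvent_pencil n N)"
proof -
  let ?R = "resolvent_pencil n N" and ?G = "geometric_mat n N"
  interpret group "loop_group n" by (rule group_SL)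
  obtain m where Nc: "N \<in> carrier_mat n n" and nil: "N ^\<^sub>m m = 0\<^sub>m n n"
    using N by (auto simp: nilpotent_cone_def)
  have RG: "?R * ?G = 1\<^sub>m n" by (rule resolvent_pencil_mult_geometric_mat[OF Nc nil])
  show R: "?R \<in> carrier (loop_group n)"
    using resolvent_pencil_carrier[OF Nc] det_resolvent_pencil[OF assms] by simp
  have "det ?R * det ?G = 1"
    using RG R geometric_mat_carrier[of n N] by (metis carrier_SL det_mult det_one)
  then show G: "?G \<in> carrier (loop_group n)"
    using R geometric_mat_carrier[of n N] by simp
  then show "?G = inv\<^bsub>loop_group n\<^esub> ?R"
    using RG R by (metis inv_equality inv_inv inv_closed mult_SL one_SL)
qed

lemma geometric_mat_intertwine:
  assumes n: "0 < n" and g: "g \<in> carrier (SLC n)"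
    and N: "N \<in> nilpotent_cone n" and N': "N' \<in> nilpotent_cone n" and eq: "g * N = N' * g"
  shows "map_mat fls_const g * geometric_mat n N = geometric_mat n N' * map_mat fls_const g"
proof -
  interpret group "loop_group n" by (rule group_SL)
  let ?g = "map_mat fls_const g" and ?R = "resolvent_pencil n"
  note R = geometric_mat_eq_inv[OF n N] and R' = geometric_mat_eq_inv[OF n N']
  have gl: "?g \<in> carrier (loop_group n)" by (rule map_fls_const_SL[OF g])
  have "?g \<otimes>\<^bsub>loop_group n\<^esub> ?R N = ?R N' \<otimes>\<^bsub>loop_group n\<^esub> ?g"
    using resolvent_pencil_intertwine[OF _ nilpotent_cone_carrier[OF N] nilpotent_cone_carrier[OF N'] eq] g
    by simp
  then have "inv\<^bsub>loop_group n\<^esub> (?R N') \<otimes>\<^bsub>loop_group n\<^esub> ?g = ?g \<otimes>\<^bsub>loop_group n\<^esub> inv\<^bsub>loop_group n\<^esub> (?R N)"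
    using gl R(1) R'(1) by (metis inv_closed inv_solve_left' inv_solve_right' m_assoc m_closed)
  then show ?thesis using R(3) R'(3) by simp
qed

section \<open>Rigidity of cosets of geometric series\<close>

text \<open>The core of both injectivity statements. Clearing the geometric series gives \<open>M (Id - t\<^sup>-\<^sup>1 N) = (Id - t\<^sup>-\<^sup>1 N') h\<close>. Writing \<open>C\<^sub>k\<close> for the coefficient
  of \<open>t\<^sup>k\<close> in \<open>M\<close>, the positive coefficients satisfy \<open>C\<^sub>k = C\<^bsub>k+1\<^esub> N\<close> and hence
  \<open>C\<^sub>k = C\<^bsub>k+m\<^esub> N\<^sup>m = 0\<close>. The coefficient of \<open>t\<^sup>0\<close> then reads \<open>C\<^sub>0 = h\<close>, and that of \<open>t\<^sup>-\<^sup>1\<close>, where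
  \<open>C\<^bsub>-1\<^esub> = 0\<close>, reads \<open>C\<^sub>0 N = N' h\<close>.\<close>
lemma coset_rigidity:
  assumes n: "0 < n" and h: "h \<in> carrier_mat n n"
    and N: "N \<in> nilpotent_cone n" and N': "N' \<in> nilpotent_cone n"
    and M: "M \<in> carrier_mat n n"
    and eq: "map_mat fls_const h * geometric_mat n N = geometric_mat n N' * map_mat fps_to_fls M"
  shows "map_mat (\<lambda>f. fps_nth f 0) M = h" and "h * N = N' * h"
proof -
  interpret group "loop_group n" by (rule group_SL)
  obtain m where Nc: "N \<in> carrier_mat n n" and nil: "N ^\<^sub>m m = 0\<^sub>m n n"
    using N by (auto simp: nilpotent_cone_def)
  note N'c = nilpotent_cone_carrier[OF N']
  let ?c = "map_mat fls_const :: complex mat \<Rightarrow> complex fls mat"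
  let ?M = "map_mat fps_to_fls M"
  let ?R = "resolvent_pencil n" and ?G = "geometric_mat n"
  have mats: "?R N \<in> carrier_mat n n" "?R N' \<in> carrier_mat n n" "?G N \<in> carrier_mat n n"
      "?G N' \<in> carrier_mat n n" "?c h \<in> carrier_mat n n" "?M \<in> carrier_mat n n"
    using Nc N'c h M by (simp_all add: resolvent_pencil_carrier geometric_mat_carrier)
  have GR: "?G N * ?R N = 1\<^sub>m n"
    using l_inv[OF geometric_mat_eq_inv(1)[OF n N]] geometric_mat_eq_inv(3)[OF n N] by simp
  have R'G': "?R N' * ?G N' = 1\<^sub>m n"
    using r_inv[OF geometric_mat_eq_inv(1)[OF n N']] geometric_mat_eq_inv(3)[OF n N'] by simp
  have "?R N' * ?c h = ?R N' * (?c h * ?G N) * ?R N"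
    using mats GR by (simp add: assoc_mult_mat[of _ n n _ n _ n])
  also have "\<dots> = (?R N' * ?G N') * ?M * ?R N"
    using mats by (simp add: eq assoc_mult_mat[of _ n n _ n _ n])
  also have "\<dots> = ?M * ?R N" using mats R'G' by simp
  finally have RM: "?M * ?R N = ?R N' * ?c h" ..
  define C where "C k = map_mat (\<lambda>f. fls_nth f k) ?M" for k
  have Cc: "C k \<in> carrier_mat n n" for k using M by (simp add: C_def)
  have coeff: "C k $$ (i, j) - (C (k + 1) * N) $$ (i, j)
      = (if k = 0 then h $$ (i, j) else 0) - (if k = - 1 then (N' * h) $$ (i, j) else 0)"
    if ij: "i < n" "j < n" for k i j
  proof -
    have "(?M * ?R N) $$ (i, j) = ?M $$ (i, j) - fls_X_inv * (?M * ?c N) $$ (i, j)"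
      unfolding resolvent_pencil_def using mats Nc ij
      by (simp add: mult_minus_distrib_mat[of _ n n _ n] mult_smult_distrib[of _ n n _ n])
    moreover have "fls_nth ((?M * ?c N) $$ (i, j)) (k + 1) = (C (k + 1) * N) $$ (i, j)"
      using mats Nc M ij by (simp add: C_def scalar_prod_def fls_nth_sum)
    ultimately have lhs: "fls_nth ((?M * ?R N) $$ (i, j)) k = C k $$ (i, j) - (C (k + 1) * N) $$ (i, j)"
      using M ij by (simp add: C_def fls_X_inv_times_conv_shift)
    have "(?R N' * ?c h) $$ (i, j) = ?c h $$ (i, j) - fls_X_inv * ?c (N' * h) $$ (i, j)"
      unfolding resolvent_pencil_def using mats N'c h ij
      by (simp add: minus_mult_distrib_mat[of _ n n _ _ n] mult_smult_assoc_mat[of _ n n _ n]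
          map_fls_const_mult[of _ n])
    then have "fls_nth ((?R N' * ?c h) $$ (i, j)) k
        = (if k = 0 then h $$ (i, j) else 0) - (if k = - 1 then (N' * h) $$ (i, j) else 0)"
      using h N'c ij by (simp add: fls_X_inv_times_conv_shift)
    then show ?thesis using lhs RM by simp
  qed
  have rec: "C k = C (k + 1) * N" if "1 \<le> k" for k
    by (rule eq_matI) (use coeff[of _ _ k] that Cc[of k] Cc[of "k + 1"] Nc in auto)
  have "C k = C (k + int l) * N ^\<^sub>m l" if "1 \<le> k" for k l
  proof (induction l)
    case 0
    then show ?case using Cc[of k] Nc by simp
  next
    case (Suc l)
    have "C (k + int l) * N ^\<^sub>m l = C (k + int l + 1) * N * N ^\<^sub>m l"
      using rec[of "k + int l"] that by simp
    also have "\<dots> = C (k + int (Suc l)) * N ^\<^sub>m Suc l"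
      using pow_mat_Suc_left[OF Nc, of l] Cc Nc
      by (simp add: assoc_mult_mat[of _ n n _ n _ n] ac_simps)
    finally show ?case using Suc by simp
  qed
  from this[of 1 m] have C1: "C 1 = 0\<^sub>m n n" using nil Cc[of "1 + int m"] by simp
  have C0: "C 0 = h"
    by (rule eq_matI) (use coeff[of _ _ 0] C1 Cc Nc h in auto)
  then show "map_mat (\<lambda>f. fps_nth f 0) M = h"
    unfolding C_def by (auto simp: mat_eq_iff)
  have "C (- 1) = 0\<^sub>m n n" using M by (auto simp: C_def)
  then show "h * N = N' * h"
    using coeff[of _ _ "- 1"] C0 Nc N'c h by (intro eq_matI) auto
qed

section \<open>Descent to the cotangent bundle and injectivity\<close>

lemma (in group) lcoset_eq_iff:
  assumes "subgroup H G" "x \<in> carrier G" "y \<in> carrier G"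
  shows "x <# H = y <# H \<longleftrightarrow> (\<exists>h\<in>H. x = y \<otimes> h)"
proof
  assume "x <# H = y <# H"
  then have "x \<in> y <# H" using lcos_self[OF assms(2,1)] by simp
  then show "\<exists>h\<in>H. x = y \<otimes> h" by (auto simp: l_coset_def)
next
  assume "\<exists>h\<in>H. x = y \<otimes> h"
  then have "x \<in> y <# H" by (auto simp: l_coset_def)
  then show "x <# H = y <# H" using l_repr_independence assms by metis
qed

lemma the_elem_image_class:
  assumes "equiv A r" "x \<in> A" "\<And>y. (x, y) \<in> r \<Longrightarrow> f y = f x"
  shows "the_elem (f ` (r `` {x})) = f x"
proof -
  have "f ` (r `` {x}) = {f x}"
  proof (intro equalityI subsetI)
    fix z assume "z \<in> f ` (r `` {x})"
    then show "z \<in> {f x}" using assms(3) by blast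
  next
    fix z assume "z \<in> {f x}"
    then show "z \<in> f ` (r `` {x})" using equiv_class_self[OF assms(1,2)] by blast
  qed
  then show ?thesis by simp
qed

lemma cotangent_rel_action:
  assumes "g \<in> carrier (SLC n)" "Y \<in> b_u n" "b \<in> borel_subgroup n"
  shows "((g, Y), (g * b, inv\<^bsub>SLC n\<^esub> b * Y * b)) \<in> cotangent_rel n"
  using assms unfolding cotangent_rel_def by blast

lemma equiv_cotangent_rel: "equiv (carrier (SLC n) \<times> b_u n) (cotangent_rel n)"
proof -
  interpret group "SLC n" by (rule group_SL)
  interpret b: subgroup "borel_subgroup n" "SLC n" by (rule subgroup_borel)
  let ?A = "carrier (SLC n) \<times> b_u n"
  have act: "inv\<^bsub>SLC n\<^esub> (b * c) * Y * (b * c) = inv\<^bsub>SLC n\<^esub> c * (inv\<^bsub>SLC n\<^esub> b * Y * b) * c"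
    if "b \<in> carrier (SLC n)" "c \<in> carrier (SLC n)" "Y \<in> b_u n" for b c Y
    using inv_mult_group[OF that(1,2)] b_u_carrier[OF that(3)] inv_SL(1)[OF that(1)] inv_SL(1)[OF that(2)]
      SL_carrier_mat[OF that(1)] SL_carrier_mat[OF that(2)]
    by (simp add: assoc_mult_mat[of _ n n _ n _ n])
  have unit: "inv\<^bsub>SLC n\<^esub> (1\<^sub>m n) * Y * 1\<^sub>m n = Y" if "Y \<in> b_u n" for Y
    using inv_one b_u_carrier[OF that] by simp
  show ?thesis
  proof (rule equivI)
    show "cotangent_rel n \<subseteq> ?A \<times> ?A"
      using b_u_conj_borel by (auto simp: cotangent_rel_def borel_subgroup_def det_mult)
    show "refl_on ?A (cotangent_rel n)"
    proof (rule refl_onI, clarify)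
      fix g Y assume *: "g \<in> carrier (SLC n)" "Y \<in> b_u n"
      have "((g, Y), (g * 1\<^sub>m n, inv\<^bsub>SLC n\<^esub> (1\<^sub>m n) * Y * 1\<^sub>m n)) \<in> cotangent_rel n"
        using * b.one_closed unfolding one_SL by (rule cotangent_rel_action)
      then show "((g, Y), (g, Y)) \<in> cotangent_rel n" using * unit right_mult_one_mat[OF SL_carrier_mat[OF *(1)]] by metis
    qed
    show "sym (cotangent_rel n)"
    proof (rule symI)
      fix p q assume "(p, q) \<in> cotangent_rel n"
      then obtain g Y b where pq: "p = (g, Y)" "q = (g * b, inv\<^bsub>SLC n\<^esub> b * Y * b)"
        and *: "g \<in> carrier (SLC n)" "Y \<in> b_u n" "b \<in> borel_subgroup n"
        by (auto simp: cotangent_rel_def)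
      let ?c = "inv\<^bsub>SLC n\<^esub> b"
      have b: "b \<in> carrier (SLC n)" using * by (auto simp: borel_subgroup_def)
      have c: "?c \<in> borel_subgroup n" using * b.m_inv_closed by simp
      have "((g * b, ?c * Y * b), (g * b * ?c, inv\<^bsub>SLC n\<^esub> ?c * (?c * Y * b) * ?c)) \<in> cotangent_rel n"
        using m_closed[OF *(1) b] b_u_conj_borel[OF *(2,3)] c unfolding mult_SL
        by (rule cotangent_rel_action)
      moreover have "g * b * ?c = g"
        using SL_carrier_mat[OF b] SL_carrier_mat[OF *(1)] inv_SL[OF b] by (simp add: assoc_mult_mat[of _ n n _ n _ n])
      moreover have "inv\<^bsub>SLC n\<^esub> ?c * (?c * Y * b) * ?c = Y"
        using act[OF b inv_closed[OF b] *(2)] inv_SL(3)[OF b] unit[OF *(2)] by simp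
      ultimately show "(q, p) \<in> cotangent_rel n" using pq by simp
    qed
    show "trans (cotangent_rel n)"
    proof (rule transI)
      fix p q r assume "(p, q) \<in> cotangent_rel n" "(q, r) \<in> cotangent_rel n"
      then obtain g Y b c where pqr: "p = (g, Y)"
          "r = (g * b * c, inv\<^bsub>SLC n\<^esub> c * (inv\<^bsub>SLC n\<^esub> b * Y * b) * c)"
        and *: "g \<in> carrier (SLC n)" "Y \<in> b_u n" "b \<in> borel_subgroup n" "c \<in> borel_subgroup n"
        by (auto simp: cotangent_rel_def)
      have bc: "b \<in> carrier (SLC n)" "c \<in> carrier (SLC n)" using * by (auto simp: borel_subgroup_def)
      have r: "r = (g * (b * c), inv\<^bsub>SLC n\<^esub> (b * c) * Y * (b * c))"
        using act[OF bc *(2)] pqr(2) m_assoc[OF *(1) bc] by simp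
      show "(p, r) \<in> cotangent_rel n"
        unfolding pqr(1) r using *(1,2) b.m_closed[OF *(3,4)] unfolding mult_SL
        by (rule cotangent_rel_action)
    qed
  qed
qed

lemma phi_matrix_in_loop_group:
  assumes "0 < n" "g \<in> carrier (SLC n)" "Y \<in> b_u n"
  shows "map_mat fls_const g * geometric_mat n Y \<in> carrier (loop_group n)"
proof -
  interpret group "loop_group n" by (rule group_SL)
  show ?thesis
    using m_closed[OF map_fls_const_SL(1)[OF assms(2)] geometric_mat_eq_inv(2)[OF assms(1) b_u_nilpotent[OF assms(3)]]]
    by simp
qed

lemma cotangent_relD:
  assumes "((g, Y), (g', Y')) \<in> cotangent_rel n"
  obtains b where "g \<in> carrier (SLC n)" "Y \<in> b_u n" "b \<in> borel_subgroup n" "b \<in> carrier (SLC n)"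
    "g' \<in> carrier (SLC n)" "Y' \<in> b_u n" "g' = g * b" "b * Y' = Y * b"
proof -
  obtain b where b: "b \<in> borel_subgroup n" "g' = g * b" and Y': "Y' = inv\<^bsub>SLC n\<^esub> b * Y * b"
    using assms by (auto simp: cotangent_rel_def)
  have mem: "g \<in> carrier (SLC n)" "Y \<in> b_u n" "g' \<in> carrier (SLC n)" "Y' \<in> b_u n"
    using assms equiv_cotangent_rel[of n] by (auto simp: equiv_def)
  have bc: "b \<in> carrier (SLC n)" using b by (simp add: borel_subgroup_def)
  have "b * Y' = (b * inv\<^bsub>SLC n\<^esub> b) * Y * b"
    unfolding Y' using bc inv_SL(1)[OF bc] b_u_carrier[OF mem(2)]
    by (simp add: assoc_mult_mat[of _ n n _ n _ n])
  then have "b * Y' = Y * b" using inv_SL(3)[OF bc] b_u_carrier[OF mem(2)] by simp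
  then show ?thesis using that mem b bc by blast
qed

lemma cotangent_relI:
  assumes "g \<in> carrier (SLC n)" "Y \<in> b_u n" "b \<in> borel_subgroup n" "g' = g * b"
    "Y' \<in> carrier_mat n n" "b * Y' = Y * b"
  shows "((g, Y), (g', Y')) \<in> cotangent_rel n"
proof -
  have bc: "b \<in> carrier (SLC n)" using assms by (simp add: borel_subgroup_def)
  have "inv\<^bsub>SLC n\<^esub> b * Y * b = inv\<^bsub>SLC n\<^esub> b * b * Y'"
    using assms(6) bc assms(5) inv_SL(1)[OF bc] b_u_carrier[OF assms(2)]
    by (simp add: assoc_mult_mat[of _ n n _ n _ n])
  then have "Y' = inv\<^bsub>SLC n\<^esub> b * Y * b" using inv_SL(4)[OF bc] assms(5) by simp
  then show ?thesis using cotangent_rel_action[OF assms(1-3)] assms(4) by simp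
qed

text \<open>The two directions say that \<open>\<phi>\<close> is well defined and injective. For injectivity, the relation
  between representatives is moved to \<open>g\<^sup>-\<^sup>1 g' G(Y') = G(Y) i\<close> with \<open>i\<close> in the Iwahori subgroup. By
  rigidity \<open>i\<close> reduces to \<open>g\<^sup>-\<^sup>1 g'\<close> at \<open>t = 0\<close>, so membership of \<open>i\<close> in the Iwahori subgroup says exactly
  that \<open>g\<^sup>-\<^sup>1 g'\<close> lies in the Borel subgroup.\<close>
lemma phi_rep_eq_iff:
  assumes n: "0 < n" and g: "g \<in> carrier (SLC n)" "g' \<in> carrier (SLC n)"
    and Y: "Y \<in> b_u n" "Y' \<in> b_u n"
  shows "phi_rep n g Y = phi_rep n g' Y' \<longleftrightarrow> ((g, Y), (g', Y')) \<in> cotangent_rel n"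
proof
  interpret L: group "loop_group n" by (rule group_SL)
  interpret S: group "SLC n" by (rule group_SL)
  note G = geometric_mat_carrier[of n]
  note coset = L.lcoset_eq_iff[OF subgroup_iwahori phi_matrix_in_loop_group[OF n g(2) Y(2)] phi_matrix_in_loop_group[OF n g(1) Y(1)]]
  {
    assume "((g, Y), (g', Y')) \<in> cotangent_rel n"
    then obtain b where b: "b \<in> borel_subgroup n" "b \<in> carrier (SLC n)" "g' = g * b" "b * Y' = Y * b"
      by (rule cotangent_relD)
    have "map_mat fls_const g' * geometric_mat n Y'
        = map_mat fls_const g * (map_mat fls_const b * geometric_mat n Y')"
      using b g G by (simp add: map_fls_const_mult[of _ n] assoc_mult_mat[of _ n n _ n _ n])
    also have "\<dots> = map_mat fls_const g * geometric_mat n Y * map_mat fls_const b"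
      using geometric_mat_intertwine[OF n b(2) b_u_nilpotent[OF Y(2)] b_u_nilpotent[OF Y(1)] b(4)] b g G
      by (simp add: assoc_mult_mat[of _ n n _ n _ n])
    finally have "phi_rep n g' Y' = phi_rep n g Y"
      unfolding phi_rep_def coset mult_SL using const_in_loop_G0(2)[OF b(2,1)] by blast
    then show "phi_rep n g Y = phi_rep n g' Y'" ..
  }
  {
    assume "phi_rep n g Y = phi_rep n g' Y'"
    then obtain i where i: "i \<in> iwahori n"
      and eq: "map_mat fls_const g' * geometric_mat n Y' = map_mat fls_const g * geometric_mat n Y * i"
      using coset unfolding phi_rep_def by auto
    obtain M where M: "M \<in> carrier_mat n n" "i = map_mat fps_to_fls M"
      and MB: "map_mat (\<lambda>f. fps_nth f 0) M \<in> borel_subgroup n"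
      using i by (auto simp: iwahori_def)
    let ?h = "inv\<^bsub>SLC n\<^esub> g * g'"
    note gi = inv_SL[OF g(1)]
    have gc: "g \<in> carrier_mat n n" "g' \<in> carrier_mat n n" using g by simp_all
    have inv: "map_mat fls_const (inv\<^bsub>SLC n\<^esub> g) * map_mat fls_const g = 1\<^sub>m n"
      using L.l_inv[OF map_fls_const_SL(1)[OF g(1)]] map_fls_const_SL(2)[OF g(1)] by simp
    have "map_mat fls_const ?h * geometric_mat n Y'
        = map_mat fls_const (inv\<^bsub>SLC n\<^esub> g) * (map_mat fls_const g * geometric_mat n Y * i)"
      using eq gc gi G by (simp add: map_fls_const_mult[of _ n] assoc_mult_mat[of _ n n _ n _ n])
    also have "\<dots> = (map_mat fls_const (inv\<^bsub>SLC n\<^esub> g) * map_mat fls_const g) * (geometric_mat n Y * i)"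
    proof -
      have "map_mat fls_const (inv\<^bsub>SLC n\<^esub> g) \<in> carrier_mat n n" "map_mat fls_const g \<in> carrier_mat n n"
        "i \<in> carrier_mat n n" using gc gi M by simp_all
      then show ?thesis using G[of Y] by (simp add: assoc_mult_mat[of _ n n _ n _ n] del: map_carrier_mat)
    qed
    also have "\<dots> = geometric_mat n Y * map_mat fps_to_fls M"
      using inv G[of Y] M by (simp add: left_mult_one_mat[of _ n n])
    finally have *: "map_mat fls_const ?h * geometric_mat n Y' = geometric_mat n Y * map_mat fps_to_fls M" .
    have hc: "?h \<in> carrier_mat n n" using gi gc by simp
    note rigid = coset_rigidity[OF n hc b_u_nilpotent[OF Y(2)] b_u_nilpotent[OF Y(1)] M(1) *]
    have "g * ?h = (g * inv\<^bsub>SLC n\<^esub> g) * g'" using gc gi(1) by (simp add: assoc_mult_mat[of _ n n _ n _ n])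
    then have "g' = g * ?h" using gi gc by simp
    then show "((g, Y), (g', Y')) \<in> cotangent_rel n"
      using cotangent_relI[OF g(1) Y(1)] MB rigid b_u_carrier[OF Y(2)] by metis
  }
qed

lemma phi_class:
  assumes n: "0 < n" and g: "g \<in> carrier (SLC n)" and Y: "Y \<in> b_u n"
  shows "phi n (cotangent_class n g Y) = phi_rep n g Y"
proof -
  have "the_elem ((\<lambda>(g, Y). phi_rep n g Y) ` cotangent_class n g Y) = (\<lambda>(g, Y). phi_rep n g Y) (g, Y)"
  proof (rule the_elem_image_class[OF equiv_cotangent_rel])
    fix p assume "((g, Y), p) \<in> cotangent_rel n"
    moreover obtain g' Y' where p: "p = (g', Y')" by fastforce
    ultimately have rel: "((g, Y), (g', Y')) \<in> cotangent_rel n" by simp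
    then obtain "g' \<in> carrier (SLC n)" "Y' \<in> b_u n" by (rule cotangent_relD)
    then show "(\<lambda>(g, Y). phi_rep n g Y) p = (\<lambda>(g, Y). phi_rep n g Y) (g, Y)"
      using phi_rep_eq_iff[OF n g _ Y, of g' Y'] rel unfolding p prod.case by metis
  qed (use g Y in simp)
  then show ?thesis by (simp add: phi_def)
qed

lemma springer_class:
  assumes g: "g \<in> carrier (SLC n)" and Y: "Y \<in> b_u n"
  shows "springer n (cotangent_class n g Y) = g * Y * inv\<^bsub>SLC n\<^esub> g"
proof -
  interpret group "SLC n" by (rule group_SL)
  let ?f = "\<lambda>(g, Y). g * Y * inv\<^bsub>SLC n\<^esub> g"
  have "the_elem (?f ` cotangent_class n g Y) = ?f (g, Y)"
  proof (rule the_elem_image_class[OF equiv_cotangent_rel])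
    fix p assume "((g, Y), p) \<in> cotangent_rel n"
    moreover obtain g' Y' where p: "p = (g', Y')" by fastforce
    ultimately obtain b where b: "b \<in> carrier (SLC n)" "Y' \<in> b_u n" "g' = g * b" "b * Y' = Y * b"
      using cotangent_relD by metis
    have mats: "g \<in> carrier_mat n n" "b \<in> carrier_mat n n" using g b by simp_all
    have "g' * Y' * inv\<^bsub>SLC n\<^esub> g' = g * (b * Y') * (inv\<^bsub>SLC n\<^esub> b * inv\<^bsub>SLC n\<^esub> g)"
      using inv_mult_group[OF g b(1)] mats inv_SL[OF g] inv_SL[OF b(1)] b_u_carrier[OF b(2)] b(3)
      by (simp add: assoc_mult_mat[of _ n n _ n _ n])
    also have "\<dots> = g * Y * (b * inv\<^bsub>SLC n\<^esub> b) * inv\<^bsub>SLC n\<^esub> g"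
      using b(4) mats inv_SL(1)[OF g] inv_SL(1)[OF b(1)] b_u_carrier[OF Y]
      by (simp add: assoc_mult_mat[of _ n n _ n _ n])
    finally show "?f p = ?f (g, Y)"
      using p mats inv_SL[OF b(1)] b_u_carrier[OF Y] by simp
  qed (use g Y in simp)
  then show ?thesis by (simp add: springer_def)
qed

lemma flag_proj_coset:
  assumes x: "x \<in> carrier (loop_group n)"
  shows "flag_proj n (x <#\<^bsub>loop_group n\<^esub> iwahori n) = x <#\<^bsub>loop_group n\<^esub> loop_G0 n"
proof -
  interpret group "loop_group n" by (rule group_SL)
  have "y <#\<^bsub>loop_group n\<^esub> loop_G0 n = x <#\<^bsub>loop_group n\<^esub> loop_G0 n"
    if y_in: "y \<in> x <#\<^bsub>loop_group n\<^esub> iwahori n" for y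
  proof -
    obtain i where i: "i \<in> iwahori n" and y: "y = x \<otimes>\<^bsub>loop_group n\<^esub> i"
      using y_in unfolding l_coset_def by blast
    have "y \<in> carrier (loop_group n)"
      unfolding y using x i subgroup.mem_carrier[OF subgroup_iwahori] by (intro m_closed) auto
    then show ?thesis
      using lcoset_eq_iff[OF subgroup_loop_G0 _ x] i y iwahori_subset by blast
  qed
  then have "(\<lambda>y. y <#\<^bsub>loop_group n\<^esub> loop_G0 n) ` (x <#\<^bsub>loop_group n\<^esub> iwahori n)
      = {x <#\<^bsub>loop_group n\<^esub> loop_G0 n}"
    using lcos_self[OF x subgroup_iwahori] by blast
  then show ?thesis by (simp add: flag_proj_def)
qed

text \<open>Modulo \<open>G\<^sub>0\<close> one has \<open>g G(Y) = g G(Y) g\<^sup>-\<^sup>1 = G(g Y g\<^sup>-\<^sup>1)\<close>.\<close>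
lemma flag_proj_phi_rep:
  assumes n: "0 < n" and g: "g \<in> carrier (SLC n)" and Y: "Y \<in> b_u n"
  shows "flag_proj n (phi_rep n g Y) = psi n (g * Y * inv\<^bsub>SLC n\<^esub> g)"
proof -
  interpret group "loop_group n" by (rule group_SL)
  let ?N = "g * Y * inv\<^bsub>SLC n\<^esub> g"
  have N: "?N \<in> nilpotent_cone n" by (rule conj_b_u_nilpotent[OF g Y])
  have "map_mat fls_const g * geometric_mat n Y = geometric_mat n ?N * map_mat fls_const g"
    using conj_SL_intertwine[OF g b_u_carrier[OF Y]]
    by (intro geometric_mat_intertwine[OF n g b_u_nilpotent[OF Y] N]) simp
  then have "(map_mat fls_const g * geometric_mat n Y) <#\<^bsub>loop_group n\<^esub> loop_G0 n = psi n ?N"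
    unfolding psi_def
      lcoset_eq_iff[OF subgroup_loop_G0 phi_matrix_in_loop_group[OF assms] geometric_mat_eq_inv(2)[OF n N]]
    using const_in_loop_G0(1)[OF g] by auto
  then show ?thesis
    unfolding phi_rep_def by (simp add: flag_proj_coset[OF phi_matrix_in_loop_group[OF assms]])
qed

text \<open>Rigidity with \<open>h = 1\<close>.\<close>
lemma inj_on_psi:
  assumes n: "0 < n"
  shows "inj_on (psi n) (nilpotent_cone n)"
proof (rule inj_onI)
  interpret group "loop_group n" by (rule group_SL)
  interpret c: comm_ring_hom "fls_const :: complex \<Rightarrow> complex fls" by (rule comm_ring_hom_fls_const)
  fix N N' assume N: "N \<in> nilpotent_cone n" and N': "N' \<in> nilpotent_cone n" and "psi n N = psi n N'"
  then obtain i where "i \<in> loop_G0 n" and i: "geometric_mat n N = geometric_mat n N' * i"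
    using lcoset_eq_iff[OF subgroup_loop_G0 geometric_mat_eq_inv(2)[OF n N] geometric_mat_eq_inv(2)[OF n N']]
    unfolding psi_def by auto
  then obtain M where M: "M \<in> carrier_mat n n" "i = map_mat fps_to_fls M"
    by (auto simp: loop_G0_def)
  have "1\<^sub>m n * N = N' * 1\<^sub>m n"
    using i geometric_mat_carrier[of n N]
    by (intro coset_rigidity(2)[OF n one_carrier_mat N N' M(1)])
      (simp add: c.mat_hom_one M(2)[symmetric] left_mult_one_mat[of _ n n])
  then show "N = N'" using nilpotent_cone_carrier[OF N] nilpotent_cone_carrier[OF N'] by simp
qed

section \<open>The Springer resolution inside the affine flag variety\<close>

lemma cotangent_bundle_cases:
  assumes "X \<in> cotangent_bundle n"
  obtains g Y where "g \<in> carrier (SLC n)" "Y \<in> b_u n" "X = cotangent_class n g Y"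
  using assms unfolding cotangent_bundle_def by (auto elim!: quotientE)

lemma cotangent_class_in_bundle:
  "g \<in> carrier (SLC n) \<Longrightarrow> Y \<in> b_u n \<Longrightarrow> cotangent_class n g Y \<in> cotangent_bundle n"
  unfolding cotangent_bundle_def by (intro quotientI) simp

lemma inj_on_phi:
  assumes n: "0 < n"
  shows "inj_on (phi n) (cotangent_bundle n)"
proof (rule inj_onI)
  fix X X' assume "X \<in> cotangent_bundle n" "X' \<in> cotangent_bundle n" and eq: "phi n X = phi n X'"
  then obtain g Y g' Y' where X: "X = cotangent_class n g Y" "X' = cotangent_class n g' Y'"
    and mem: "g \<in> carrier (SLC n)" "Y \<in> b_u n" "g' \<in> carrier (SLC n)" "Y' \<in> b_u n"
    by (metis cotangent_bundle_cases)
  have "((g, Y), (g', Y')) \<in> cotangent_rel n"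
    using eq X phi_class[OF n] mem phi_rep_eq_iff[OF n mem(1,3,2,4)] by metis
  then show "X = X'" unfolding X by (rule equiv_class_eq[OF equiv_cotangent_rel])
qed

theorem mainTheorem3:
  fixes n :: nat
  assumes "n \<ge> 2"
  shows "equiv (carrier (SLC n) \<times> b_u n) (cotangent_rel n)
    \<and> (\<forall>g \<in> carrier (SLC n). \<forall>Y \<in> b_u n.
           phi n (cotangent_class n g Y) = phi_rep n g Y
         \<and> springer n (cotangent_class n g Y) = g * Y * inv\<^bsub>SLC n\<^esub> g)
    \<and> (\<forall>x \<in> carrier (loop_group n).
           flag_proj n (x <#\<^bsub>loop_group n\<^esub> iwahori n) = x <#\<^bsub>loop_group n\<^esub> loop_G0 n)
    \<and> phi n \<in> cotangent_bundle n \<rightarrow> affine_flags n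
    \<and> inj_on (phi n) (cotangent_bundle n)
    \<and> psi n \<in> nilpotent_cone n \<rightarrow> affine_grassmannian n
    \<and> inj_on (psi n) (nilpotent_cone n)
    \<and> springer n \<in> cotangent_bundle n \<rightarrow> nilpotent_cone n
    \<and> flag_proj n ` phi n ` cotangent_bundle n = psi n ` nilpotent_cone n
    \<and> (\<forall>X \<in> cotangent_bundle n. flag_proj n (phi n X) = psi n (springer n X))
    \<and> (\<forall>g \<in> carrier (SLC n). \<forall>Y \<in> b_u n.
           flag_proj n (phi n (cotangent_class n g Y)) = psi n (g * Y * inv\<^bsub>SLC n\<^esub> g))"
proof -
  have n: "0 < n" using assms by simp
  have proj: "flag_proj n (phi n (cotangent_class n g Y)) = psi n (g * Y * inv\<^bsub>SLC n\<^esub> g)"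
    if "g \<in> carrier (SLC n)" "Y \<in> b_u n" for g Y
    using phi_class[OF n that] flag_proj_phi_rep[OF n that] by simp
  have square: "flag_proj n (phi n X) = psi n (springer n X)" if "X \<in> cotangent_bundle n" for X
    using that by (rule cotangent_bundle_cases) (simp only: proj springer_class)
  have phi: "phi n X \<in> affine_flags n" if "X \<in> cotangent_bundle n" for X
    using that
  proof (rule cotangent_bundle_cases)
    fix g Y assume "g \<in> carrier (SLC n)" "Y \<in> b_u n" "X = cotangent_class n g Y"
    then show ?thesis
      using phi_class[OF n, of g Y] phi_matrix_in_loop_group[OF n, of g Y]
      unfolding LCOSETS_def phi_rep_def by blast
  qed
  have psi: "psi n N \<in> affine_grassmannian n" if "N \<in> nilpotent_cone n" for N
    using geometric_mat_eq_inv(2)[OF n that] unfolding LCOSETS_def psi_def by blast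
  have springer: "springer n ` cotangent_bundle n = nilpotent_cone n"
  proof (intro equalityI subsetI)
    fix N assume "N \<in> springer n ` cotangent_bundle n"
    then obtain X where "X \<in> cotangent_bundle n" and N: "N = springer n X" by blast
    then obtain g Y where gY: "g \<in> carrier (SLC n)" "Y \<in> b_u n" and "X = cotangent_class n g Y"
      by (elim cotangent_bundle_cases)
    then show "N \<in> nilpotent_cone n"
      unfolding N using conj_b_u_nilpotent[OF gY] springer_class[OF gY] by simp
  next
    fix N assume "N \<in> nilpotent_cone n"
    then obtain g Y where gY: "g \<in> carrier (SLC n)" "Y \<in> b_u n"
      and N: "N = g * Y * inv\<^bsub>SLC n\<^esub> g"
      by (rule nilpotent_conj_b_u[OF n])
    show "N \<in> springer n ` cotangent_bundle n"
      unfolding N springer_class[OF gY, symmetric]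
      using cotangent_class_in_bundle[OF gY] by (rule imageI)
  qed
  have "flag_proj n ` phi n ` cotangent_bundle n = psi n ` springer n ` cotangent_bundle n"
    unfolding image_image using square by (rule image_cong[OF refl])
  then have image: "flag_proj n ` phi n ` cotangent_bundle n = psi n ` nilpotent_cone n"
    by (simp only: springer)
  show ?thesis
  proof (intro conjI ballI Pi_I)
    show "springer n X \<in> nilpotent_cone n" if "X \<in> cotangent_bundle n" for X
      using that springer by (metis imageI)
  qed (rule equiv_cotangent_rel phi_class[OF n] springer_class flag_proj_coset phi inj_on_phi[OF n] psi
      inj_on_psi[OF n] image square proj; assumption)+
qed

end
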